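(* Let $\mathcal{G}=(\mathcal{V},\mathcal{E},w)$ be a strongly connected directed graph with positive edge weights, let $\alpha\in[0,1]$, and consider the influenced leader system on $\mathcal{G}$ with $S_0=\{s_0\}$, $S_1=\{s_1\}$, $s_0\ne s_1$, where $s_0$ has stubbornness $\kappa_0>0$ and $s_1$ has stubbornness $\kappa_1>0$. Then $$f(S_1,\alpha)=\frac{\left|(1-\alpha)\left(\frac{d_{s_0}}{\kappa_0\pi_{s_0}}+D^{\mathcal{G}}_{s_1,s_0}\right)-\alpha\left(\frac{d_{s_1}}{\kappa_1\pi_{s_1}}+D^{\mathcal{G}}_{s_0,s_1}\right)\right|}{\left(\frac{d_{s_0}}{\kappa_0\pi_{s_0}}+D^{\mathcal{G}}_{s_1,s_0}\right)+\left(\frac{d_{s_1}}{\kappa_1\pi_{s_1}}+D^{\mathcal{G}}_{s_0,s_1}\right)},$$ where $d_v=D_{v,v}$ is the weighted out-degree of $v$ and $\pi$ is the stationary distribution of the random walk on $\mathcal{G}$.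
   Context: For a weighted directed graph, $A$ is the adjacency matrix ($A_{u,v}=w(u,v)$ if $(u,v)\in\mathcal{E}$, else $0$), $D$ is the diagonal out-degree matrix $D_{u,u}=\sum_v A_{u,v}$, $L=D-A$, and $W=A^\top D^{-1}$. $\pi$ is the stationary distribution ($\pi=W\pi$, $\pi>0$, $\sum_v\pi_v=1$), $\Pi=\mathrm{diag}(\pi)$, and $\mathcal{L}=\Pi(I-W^\top)$; $\dagger$ denotes the Moore–Penrose pseudoinverse. Domination score of node $u$ over node $v$: $D^{\mathcal{G}}_{u,v}=(\mathcal{L}^\dagger)_{v,v}-(\mathcal{L}^\dagger)_{v,u}$ (not to be confused with the entries of the degree matrix $D$). Influenced leader system with disjoint leader sets $S_0$ (reference value $0$) and $S_1$ (reference value $1$): with $S=S_0\cup S_1$, $K$ the diagonal matrix of stubbornness values and $E^T$ the diagonal $0/1$ indicator matrix of a node set $T$, the dynamics are $\dot x=-(L+E^SK)x+E^{S_1}K\mathbf{1}$, with steady state $\hat x=(L+E^SK)^{-1}E^{S_1}K\mathbf{1}$. The average opinion is $\mu(S_1)=\frac1n\sum_{v\in\mathcal{V}}\hat x_v$, $n=|\mathcal{V}|$, and $f(S_1,\alpha)=|\mu(S_1)-\alpha|$. *)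

theory Defs
  imports "HOL-Analysis.Analysis"
begin

section \<open>Matrices\<close>

definition diag :: "real ^ 'n \<Rightarrow> real ^ 'n ^ 'n" where
  "diag x = (\<chi> i j. if i = j then x $ i else 0)"

definition is_pseudoinverse :: "real ^ 'n ^ 'm \<Rightarrow> real ^ 'm ^ 'n \<Rightarrow> bool" where
  "is_pseudoinverse M X \<longleftrightarrow>
     M ** X ** M = M \<and> X ** M ** X = X \<and>
     transpose (M ** X) = M ** X \<and> transpose (X ** M) = X ** M"

definition pseudoinverse :: "real ^ 'n ^ 'm \<Rightarrow> real ^ 'm ^ 'n" where
  "pseudoinverse M = (THE X. is_pseudoinverse M X)"

lemma is_pseudoinverse_unique:
  fixes M :: "real ^ 'n ^ 'm"
  assumes "is_pseudoinverse M X" "is_pseudoinverse M Y"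
  shows "X = Y"
proof -
  have MX: "M ** X = M ** Y"
  proof -
    have "M ** X = transpose (M ** Y ** (M ** X))"
      using assms by (simp add: is_pseudoinverse_def matrix_mul_assoc)
    also have "\<dots> = M ** X ** (M ** Y)"
      using assms by (simp only: is_pseudoinverse_def matrix_transpose_mul)
    also have "\<dots> = M ** Y"
      using assms by (simp add: is_pseudoinverse_def matrix_mul_assoc)
    finally show ?thesis .
  qed
  have XM: "X ** M = Y ** M"
  proof -
    have "X ** M = transpose (X ** M ** (Y ** M))"
      using assms by (metis is_pseudoinverse_def matrix_mul_assoc)
    also have "\<dots> = Y ** M ** (X ** M)"
      using assms by (simp only: is_pseudoinverse_def matrix_transpose_mul)
    also have "\<dots> = Y ** M"
      using assms by (metis is_pseudoinverse_def matrix_mul_assoc)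
    finally show ?thesis .
  qed
  have "X = X ** M ** X" using assms by (simp add: is_pseudoinverse_def)
  also have "\<dots> = Y ** M ** Y" using MX XM by (metis matrix_mul_assoc)
  also have "\<dots> = Y" using assms by (simp add: is_pseudoinverse_def)
  finally show ?thesis .
qed

section \<open>Weighted directed graphs\<close>

text \<open>A weighted directed graph has the finite type \<open>'v\<close> as its vertex set, an edge
  relation \<open>E\<close> (self-loops are permitted) and a weight function \<open>w\<close>,
  whose values outside \<open>E\<close> are irrelevant.\<close>

definition strongly_connected :: "'v rel \<Rightarrow> bool" where
  "strongly_connected E \<longleftrightarrow> (\<forall>u v. (u, v) \<in> E\<^sup>*)"

definition adjacency :: "('v::finite) rel \<Rightarrow> ('v \<times> 'v \<Rightarrow> real) \<Rightarrow> real ^ 'v ^ 'v" where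
  "adjacency E w = (\<chi> u v. if (u, v) \<in> E then w (u, v) else 0)"

definition out_degree :: "('v::finite) rel \<Rightarrow> ('v \<times> 'v \<Rightarrow> real) \<Rightarrow> 'v \<Rightarrow> real" where
  "out_degree E w u = (\<Sum>v\<in>UNIV. adjacency E w $ u $ v)"

definition degree_matrix :: "('v::finite) rel \<Rightarrow> ('v \<times> 'v \<Rightarrow> real) \<Rightarrow> real ^ 'v ^ 'v" where
  "degree_matrix E w = diag (\<chi> u. out_degree E w u)"

definition laplacian :: "('v::finite) rel \<Rightarrow> ('v \<times> 'v \<Rightarrow> real) \<Rightarrow> real ^ 'v ^ 'v" where
  "laplacian E w = degree_matrix E w - adjacency E w"

definition walk_matrix :: "('v::finite) rel \<Rightarrow> ('v \<times> 'v \<Rightarrow> real) \<Rightarrow> real ^ 'v ^ 'v" where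
  "walk_matrix E w = transpose (adjacency E w) ** matrix_inv (degree_matrix E w)"

definition is_stationary ::
    "('v::finite) rel \<Rightarrow> ('v \<times> 'v \<Rightarrow> real) \<Rightarrow> real ^ 'v \<Rightarrow> bool" where
  "is_stationary E w p \<longleftrightarrow>
     p = walk_matrix E w *v p \<and> (\<forall>v. p $ v > 0) \<and> (\<Sum>v\<in>UNIV. p $ v) = 1"

text \<open>For a strongly connected graph with positive weights and at least two vertices,
  the stationary distribution exists and is unique.\<close>

definition stationary_distribution ::
    "('v::finite) rel \<Rightarrow> ('v \<times> 'v \<Rightarrow> real) \<Rightarrow> real ^ 'v" where
  "stationary_distribution E w = (THE p. is_stationary E w p)"

definition stationary_laplacian ::
    "('v::finite) rel \<Rightarrow> ('v \<times> 'v \<Rightarrow> real) \<Rightarrow> real ^ 'v ^ 'v" where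
  "stationary_laplacian E w =
     diag (stationary_distribution E w) ** (mat 1 - transpose (walk_matrix E w))"

definition domination ::
    "('v::finite) rel \<Rightarrow> ('v \<times> 'v \<Rightarrow> real) \<Rightarrow> 'v \<Rightarrow> 'v \<Rightarrow> real" where
  "domination E w u v =
     pseudoinverse (stationary_laplacian E w) $ v $ v -
     pseudoinverse (stationary_laplacian E w) $ v $ u"

section \<open>Influenced leader systems\<close>

definition node_indicator :: "('v::finite) set \<Rightarrow> real ^ 'v ^ 'v" where
  "node_indicator T = diag (\<chi> v. if v \<in> T then 1 else 0)"

text \<open>The stubbornness values are a vector \<open>k\<close> over all nodes; only its entries at
  leaders matter, since the matrix \<open>diag k\<close> is always masked by a leader indicator.
  The system is
  \<open>x' = - (laplacian E w + node_indicator (S0 \<union> S1) ** diag k) *v x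
        + (node_indicator S1 ** diag k) *v 1\<close>.\<close>

definition steady_state ::
    "('v::finite) rel \<Rightarrow> ('v \<times> 'v \<Rightarrow> real) \<Rightarrow> real ^ 'v \<Rightarrow> 'v set \<Rightarrow> 'v set \<Rightarrow> real ^ 'v"
  where
  "steady_state E w k S0 S1 =
     matrix_inv (laplacian E w + node_indicator (S0 \<union> S1) ** diag k) *v
       ((node_indicator S1 ** diag k) *v (\<chi> v. 1))"

definition average_opinion ::
    "('v::finite) rel \<Rightarrow> ('v \<times> 'v \<Rightarrow> real) \<Rightarrow> real ^ 'v \<Rightarrow> 'v set \<Rightarrow> 'v set \<Rightarrow> real" where
  "average_opinion E w k S0 S1 =
     (1 / real CARD('v)) * (\<Sum>v\<in>UNIV. steady_state E w k S0 S1 $ v)"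

definition opinion_deviation ::
    "('v::finite) rel \<Rightarrow> ('v \<times> 'v \<Rightarrow> real) \<Rightarrow> real ^ 'v \<Rightarrow> 'v set \<Rightarrow> 'v set \<Rightarrow> real \<Rightarrow> real"
  where
  "opinion_deviation E w k S0 S1 \<alpha> = \<bar>average_opinion E w k S0 S1 - \<alpha>\<bar>"

end

theory Submission
  imports Defs
begin

text \<open>Multiplying the steady-state equation by \<open>diag (\<pi>\<^sub>v / d\<^sub>v)\<close> turns the Laplacian into the stationary
  Laplacian \<open>M\<close>, whose rows and columns sum to zero, and gives \<open>M x = t (e\<^sub>1 - e\<^sub>0)\<close>, where \<open>t\<close> is the
  flux from the leader \<open>s1\<close> to the leader \<open>s0\<close>. Since \<open>M\<^sup>\<dagger> M\<close> is the projection orthogonal to the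
  constants, \<open>x = \<mu> + t M\<^sup>\<dagger> (e\<^sub>1 - e\<^sub>0)\<close>, and reading off the entries at the two leaders gives
  \<open>\<mu> = t a\<close> and \<open>1 - \<mu> = t b\<close>. Hence \<open>t (a + b) = 1\<close> and \<open>\<mu> = a / (a + b)\<close>; the minimum principle
  for the Laplacian gives \<open>t > 0\<close>, so \<open>a + b > 0\<close>.\<close>

section \<open>Diagonal matrices, inverses and the Laplacian entrywise\<close>

lemma diag_nth: "diag x $ i $ j = (if i = j then x $ i else 0)"
  by (simp add: diag_def)

lemma diag_mult_vector_nth: "(diag x *v y) $ i = x $ i * y $ i"
  by (simp add: matrix_vector_mult_def diag_nth if_distrib[of "\<lambda>a. a * _"] cong: if_cong)

lemma diag_mult_diag: "diag x ** diag y = diag (\<chi> i. x $ i * y $ i)"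
  by (simp add: vec_eq_iff matrix_matrix_mult_def diag_nth if_distrib[of "\<lambda>a. a * _"] cong: if_cong)

lemma matrix_add_rdistrib: "(A + B) ** C = A ** C + B ** C"
  by (simp add: vec_eq_iff matrix_matrix_mult_def distrib_right sum.distrib)

lemma matrix_diff_ldistrib:
  fixes A :: "real ^ 'n ^ 'm"
  shows "A ** (B - C) = A ** B - A ** C"
  by (simp add: vec_eq_iff matrix_matrix_mult_def right_diff_distrib sum_subtractf)

lemma matrix_diff_rdistrib:
  fixes A B :: "real ^ 'n ^ 'm"
  shows "(A - B) ** C = A ** C - B ** C"
  by (simp add: vec_eq_iff matrix_matrix_mult_def left_diff_distrib sum_subtractf)

lemma
  fixes A :: "real ^ 'n ^ 'n"
  assumes "invertible A"
  shows matrix_inv_right: "A ** matrix_inv A = mat 1"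
    and matrix_inv_left: "matrix_inv A ** A = mat 1"
proof -
  have "\<exists>B. A ** B = mat 1 \<and> B ** A = mat 1"
    using assms by (simp add: invertible_def)
  then have "A ** matrix_inv A = mat 1 \<and> matrix_inv A ** A = mat 1"
    unfolding matrix_inv_def by (rule someI_ex)
  then show "A ** matrix_inv A = mat 1" "matrix_inv A ** A = mat 1" by auto
qed

lemma matrix_inv_unique:
  fixes A B :: "real ^ 'n ^ 'n"
  assumes "A ** B = mat 1"
  shows "matrix_inv A = B"
proof -
  have "invertible A"
    using assms matrix_left_right_inverse unfolding invertible_def by blast
  then have "matrix_inv A ** A ** B = B"
    by (simp add: matrix_inv_left)
  then show ?thesis
    by (simp add: assms flip: matrix_mul_assoc)
qed

lemma matrix_inv_diag:
  assumes "\<And>i. x $ i \<noteq> 0"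
  shows "matrix_inv (diag x) = diag (\<chi> i. inverse (x $ i))"
  by (rule matrix_inv_unique)
    (use assms in \<open>auto simp: diag_mult_diag vec_eq_iff diag_nth mat_def\<close>)

lemma invertible_if_injective:
  fixes A :: "real ^ 'n ^ 'n"
  assumes "\<And>x. A *v x = 0 \<Longrightarrow> x = 0"
  shows "invertible A"
  using assms by (simp add: invertible_left_inverse matrix_left_invertible_ker)

lemma matrix_inv_mult_vector:
  fixes A :: "real ^ 'n ^ 'n"
  assumes "invertible A"
  shows "A *v (matrix_inv A *v b) = b"
  by (simp add: assms matrix_inv_right matrix_vector_mul_assoc)

lemma pseudoinverse_eq:
  assumes "is_pseudoinverse M X"
  shows "pseudoinverse M = X"
  unfolding pseudoinverse_def
  by (rule the_equality[where P = "is_pseudoinverse M", OF assms])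
    (rule is_pseudoinverse_unique[OF _ assms])

text \<open>In terms of differences, the sign of every summand is evident at an extremal vertex, and
  constants visibly lie in the kernel.\<close>

lemma laplacian_mult_vector_nth:
  fixes x :: "real ^ 'v::finite"
  shows "(laplacian E w *v x) $ v = (\<Sum>u\<in>UNIV. adjacency E w $ v $ u * (x $ v - x $ u))"
proof -
  have "(laplacian E w *v x) $ v = out_degree E w v * x $ v - (adjacency E w *v x) $ v"
    by (simp add: laplacian_def degree_matrix_def matrix_vector_mult_diff_rdistrib
        diag_mult_vector_nth)
  then show ?thesis
    by (simp add: out_degree_def matrix_vector_mult_def right_diff_distrib sum_subtractf
        sum_distrib_right)
qed

section \<open>The orthogonal projection onto the constants, and the pseudoinverse\<close>

definition averaging_matrix :: "real ^ 'n ^ 'n" where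
  "averaging_matrix = (\<chi> i j. 1 / real CARD('n))"

lemma averaging_matrix_mult_vector_nth:
  fixes x :: "real ^ 'n"
  shows "(averaging_matrix *v x) $ i = (\<Sum>j\<in>UNIV. x $ j) / real CARD('n)"
  by (simp add: averaging_matrix_def matrix_vector_mult_def sum_divide_distrib)

lemma averaging_matrix_idem:
  "averaging_matrix ** averaging_matrix = (averaging_matrix :: real ^ 'n ^ 'n)"
  by (simp add: averaging_matrix_def matrix_matrix_mult_def vec_eq_iff)

text \<open>If the constants span the kernel of \<open>M\<close> and are orthogonal to its range, then adding the
  projection onto the constants makes \<open>M\<close> invertible, and removing that projection from the
  inverse gives the pseudoinverse.\<close>

lemma is_pseudoinverse_if_kernel_constants:
  fixes M :: "real ^ 'n ^ 'n"
  assumes MJ: "M ** averaging_matrix = 0" and JM: "averaging_matrix ** M = 0"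
    and ker: "\<And>x i j. M *v x = 0 \<Longrightarrow> x $ i = x $ j"
  obtains X where "is_pseudoinverse M X" "X ** M = mat 1 - averaging_matrix"
proof -
  let ?J = "averaging_matrix :: real ^ 'n ^ 'n"
  let ?N = "M + ?J"
  define Y where "Y = matrix_inv ?N"
  have inv: "invertible ?N"
  proof (rule invertible_if_injective)
    fix x :: "real ^ 'n"
    assume 0: "?N *v x = 0"
    \<comment> \<open>Multiplying by \<open>?J\<close> separates the two summands: it kills
      \<open>M\<close> and fixes \<open>?J\<close>, so both parts of \<open>?N *v x\<close>
      vanish.\<close>
    have "?J *v x = (?J ** ?N) *v x"
      by (simp add: matrix_add_ldistrib JM averaging_matrix_idem)
    then have J: "?J *v x = 0"
      by (metis 0 matrix_vector_mul_assoc matrix_vector_mult_0_right)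
    then have "M *v x = 0"
      using 0 by (simp add: matrix_vector_mult_add_rdistrib)
    then have sum: "(\<Sum>j\<in>UNIV. x $ j) = (\<Sum>j\<in>(UNIV :: 'n set). x $ i)" for i
      using ker by (intro sum.cong) blast+
    have "(?J *v x) $ i = x $ i" for i
      by (simp add: averaging_matrix_mult_vector_nth sum[of i])
    then show "x = 0" using J by (simp add: vec_eq_iff)
  qed
  have NY: "?N ** Y = mat 1" and YN: "Y ** ?N = mat 1"
    using inv by (simp_all add: Y_def matrix_inv_left matrix_inv_right)
  have NJ: "?N ** ?J = ?J" and JN: "?J ** ?N = ?J"
    by (simp_all add: matrix_add_ldistrib matrix_add_rdistrib MJ JM averaging_matrix_idem)
  \<comment> \<open>Multiplication by \<open>?N\<close> on either side fixes \<open>?J\<close>,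
    hence so does multiplication by its inverse.\<close>
  have YJ: "Y ** ?J = ?J"
    by (metis NJ YN matrix_mul_assoc matrix_mul_lid)
  have JY: "?J ** Y = ?J"
    by (metis JN NY matrix_mul_assoc matrix_mul_rid)
  have MY: "M ** Y = mat 1 - ?J"
    using NY JY by (simp add: matrix_add_rdistrib eq_diff_eq)
  have YM: "Y ** M = mat 1 - ?J"
    using YN YJ by (simp add: matrix_add_ldistrib eq_diff_eq)
  define X where "X = Y - ?J"
  have MX: "M ** X = mat 1 - ?J"
    by (simp add: X_def matrix_diff_ldistrib MY MJ)
  have XM: "X ** M = mat 1 - ?J"
    by (simp add: X_def matrix_diff_rdistrib YM JM)
  have "X ** M ** X = X"
    by (simp add: XM) (simp add: X_def matrix_diff_ldistrib matrix_diff_rdistrib JY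
        averaging_matrix_idem)
  moreover have "M ** X ** M = M"
    by (simp add: MX matrix_diff_rdistrib JM)
  moreover have "transpose (mat 1 - ?J) = mat 1 - ?J"
    by (simp add: averaging_matrix_def transpose_def mat_def vec_eq_iff)
  ultimately show thesis
    using that[OF _ XM] by (simp add: is_pseudoinverse_def MX XM)
qed

section \<open>Strong connectivity and the minimum principle\<close>

locale strongly_connected_digraph =
  fixes E :: "('v::finite) rel" and w :: "'v \<times> 'v \<Rightarrow> real"
  assumes strong: "strongly_connected E"
    and weight_pos: "e \<in> E \<Longrightarrow> w e > 0"
    and nontrivial: "\<exists>u v :: 'v. u \<noteq> v"
begin

abbreviation "A \<equiv> adjacency E w"
abbreviation "L \<equiv> laplacian E w"
abbreviation "W \<equiv> walk_matrix E w"
abbreviation "deg \<equiv> out_degree E w"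

lemma adjacency_nonneg: "A $ u $ v \<ge> 0"
  using weight_pos[of "(u, v)"] by (auto simp: adjacency_def)

lemma adjacency_pos: "(u, v) \<in> E \<Longrightarrow> A $ u $ v > 0"
  using weight_pos[of "(u, v)"] by (auto simp: adjacency_def)

lemma propagate:
  assumes "P u" and "\<And>u v. P u \<Longrightarrow> (u, v) \<in> E \<Longrightarrow> P v"
  shows "P v"
proof -
  have "(u, v) \<in> E\<^sup>*" using strong by (simp add: strongly_connected_def)
  then show ?thesis by induction (use assms in auto)
qed

text \<open>A path to a second vertex must begin with an edge leaving \<open>u\<close>. A single
  vertex without a self-loop would have out-degree zero, hence the assumption of two
  vertices.\<close>

lemma out_degree_pos: "deg u > 0"
proof -
  obtain v where "v \<noteq> u" using nontrivial by metis
  moreover have "(u, v) \<in> E\<^sup>*" using strong by (simp add: strongly_connected_def)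
  ultimately obtain z where "(u, z) \<in> E" by (metis converse_rtranclE)
  then have "0 < A $ u $ z" by (rule adjacency_pos)
  also have "\<dots> \<le> deg u"
    unfolding out_degree_def by (rule member_le_sum) (auto simp: adjacency_nonneg)
  finally show ?thesis .
qed

text \<open>At a minimal vertex every term of \<open>L *v x\<close> is nonpositive, so the assumed
  sign makes all terms vanish and every out-neighbour is minimal too; strong connectivity spreads
  this to all vertices. Asking for the sign at minimizers only allows the wrong sign elsewhere, for
  instance at a leader.\<close>

lemma minimum_principle:
  fixes x :: "real ^ 'v"
  assumes "\<And>v. (\<And>u. x $ v \<le> x $ u) \<Longrightarrow> (L *v x) $ v \<ge> 0"
  shows "x $ u = x $ v"
proof -
  have "Min (range (($) x)) \<in> range (($) x)" by (intro Min_in) auto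
  then obtain m where m: "Min (range (($) x)) = x $ m" by (rule imageE)
  have min: "x $ m \<le> x $ u" for u by (simp flip: m)
  have "x $ v = x $ m" for v
  proof (rule propagate[where P = "\<lambda>v. x $ v = x $ m" and u = m])
    fix u v assume u: "x $ u = x $ m" and e: "(u, v) \<in> E"
    let ?f = "\<lambda>v. A $ u $ v * (x $ v - x $ u)"
    have "(\<Sum>v\<in>UNIV. ?f v) = - (L *v x) $ u"
      by (simp add: laplacian_mult_vector_nth flip: sum_negf mult_minus_right)
    also have "\<dots> \<le> 0"
      using assms[of u] min u by simp
    finally have "(\<Sum>v\<in>UNIV. ?f v) \<le> 0" .
    moreover have nn: "?f v \<ge> 0" for v
      using min u adjacency_nonneg by simp
    ultimately have "?f v = 0"
      using sum_nonneg_eq_0_iff[of UNIV ?f] sum_nonneg[of UNIV ?f] by fastforce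
    then show "x $ v = x $ m" using adjacency_pos[OF e] u by simp
  qed simp
  then show ?thesis by metis
qed

section \<open>The random walk and its stationary distribution\<close>

lemma walk_matrix_nth: "W $ v $ u = A $ u $ v / deg u"
proof -
  have "W = transpose A ** diag (\<chi> u. inverse (deg u))"
    using out_degree_pos
    by (simp add: walk_matrix_def degree_matrix_def matrix_inv_diag less_imp_neq[symmetric])
  then show ?thesis
    by (simp add: matrix_matrix_mult_def diag_nth transpose_def divide_inverse
        if_distrib[of "\<lambda>a. _ * a"] cong: if_cong)
qed

lemma walk_matrix_nonneg: "W $ v $ u \<ge> 0"
  by (simp add: walk_matrix_nth adjacency_nonneg less_imp_le out_degree_pos)

lemma walk_matrix_column_sum: "(\<Sum>v\<in>UNIV. W $ v $ u) = 1"
  using out_degree_pos[of u]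
  by (simp add: walk_matrix_nth flip: sum_divide_distrib out_degree_def)

lemma walk_matrix_sum: "(\<Sum>v\<in>UNIV. (W *v p) $ v) = (\<Sum>v\<in>UNIV. p $ v)"
proof -
  have "(\<Sum>v\<in>UNIV. (W *v p) $ v) = (\<Sum>u\<in>UNIV. (\<Sum>v\<in>UNIV. W $ v $ u) * p $ u)"
    unfolding matrix_vector_mult_def sum_distrib_right by simp (rule sum.swap)
  then show ?thesis by (simp add: walk_matrix_column_sum)
qed

text \<open>Along an edge from \<open>u\<close> to \<open>v\<close>, the entry \<open>p $ v\<close>
  is at least the mass \<open>W $ v $ u * p $ u\<close> passed on by \<open>u\<close>, so positivity
  travels along edges.\<close>

lemma fixed_point_pos:
  fixes p :: "real ^ 'v"
  assumes fixed: "W *v p = p" and nonneg: "\<And>v. p $ v \<ge> 0" and "p $ u > 0"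
  shows "p $ v > 0"
proof (rule propagate[where P = "\<lambda>v. p $ v > 0" and u = u])
  fix u v assume u: "p $ u > 0" and e: "(u, v) \<in> E"
  have "0 < W $ v $ u * p $ u"
    using u adjacency_pos[OF e] out_degree_pos by (simp add: walk_matrix_nth)
  also have "\<dots> \<le> (\<Sum>u\<in>UNIV. W $ v $ u * p $ u)"
    by (rule member_le_sum) (auto simp: walk_matrix_nonneg nonneg)
  also have "\<dots> = p $ v"
    by (subst (2) fixed[symmetric]) (simp add: matrix_vector_mult_def)
  finally show "p $ v > 0" .
qed fact

text \<open>Columns of \<open>W\<close> sum to one, so 1 is an eigenvalue of
  \<open>transpose W\<close> and hence of \<open>W\<close>. For an eigenvector \<open>q\<close>, the
  triangle inequality bounds its entrywise absolute value \<open>p\<close> by \<open>W *v p\<close>;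
  as \<open>W\<close> preserves the total, equality holds, and normalizing \<open>p\<close> gives
  the distribution.\<close>

lemma is_stationary_exists: "\<exists>p. is_stationary E w p"
proof -
  have "(transpose W - mat 1) *v (\<chi> v. 1) = 0"
    by (simp add: vec_eq_iff matrix_vector_mult_diff_rdistrib vector_matrix_mult_def
        walk_matrix_column_sum)
  moreover have "(\<chi> v. 1) \<noteq> (0 :: real ^ 'v)" by (simp add: vec_eq_iff)
  ultimately have "\<not> invertible (transpose W - mat 1)"
    using invertible_left_inverse matrix_left_invertible_ker by blast
  moreover have "transpose W - mat 1 = transpose (W - mat 1)"
    by (simp add: vec_eq_iff transpose_def mat_def)
  ultimately have "\<not> invertible (W - mat 1)"
    using transpose_invertible by metis
  then obtain q where "q \<noteq> 0" "(W - mat 1) *v q = 0"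
    using invertible_if_injective by blast
  then have q: "W *v q = q" by (simp add: matrix_vector_mult_diff_rdistrib)
  define p where "p = (\<chi> v. \<bar>q $ v\<bar>)"
  have le: "p $ v \<le> (W *v p) $ v" for v
  proof -
    have "p $ v = \<bar>(W *v q) $ v\<bar>" by (simp add: p_def q)
    also have "\<dots> \<le> (\<Sum>u\<in>UNIV. \<bar>W $ v $ u * q $ u\<bar>)"
      by (simp add: matrix_vector_mult_def sum_abs)
    also have "\<dots> = (W *v p) $ v"
      by (simp add: matrix_vector_mult_def p_def abs_mult walk_matrix_nonneg)
    finally show ?thesis .
  qed
  have "(\<Sum>v\<in>UNIV. (W *v p) $ v - p $ v) = 0"
    by (simp add: sum_subtractf walk_matrix_sum)
  then have "(W *v p) $ v - p $ v = 0" for v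
    using le by (subst (asm) sum_nonneg_eq_0_iff) auto
  then have p: "W *v p = p" by (simp add: vec_eq_iff)
  obtain u where "q $ u \<noteq> 0" using \<open>q \<noteq> 0\<close> by (auto simp: vec_eq_iff)
  then have "p $ u > 0" by (simp add: p_def)
  then have pos: "p $ v > 0" for v
    by (rule fixed_point_pos[OF p, rotated]) (simp add: p_def)
  define c where "c = (\<Sum>v\<in>UNIV. p $ v)"
  have c: "c > 0" unfolding c_def by (rule sum_pos) (auto simp: pos)
  have "is_stationary E w (inverse c *\<^sub>R p)"
    using c pos p
    by (simp add: is_stationary_def matrix_vector_mult_scaleR flip: sum_distrib_left c_def)
  then show ?thesis by blast
qed

text \<open>Subtracting the largest multiple of \<open>q\<close> that stays below \<open>p\<close> leaves a nonnegative fixed point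
  with a zero entry, which must vanish.\<close>

lemma is_stationary_unique:
  assumes p: "is_stationary E w p" and q: "is_stationary E w q"
  shows "p = q"
proof -
  define f where "f v = p $ v / q $ v" for v
  have "Min (range f) \<in> range f" by (intro Min_in) auto
  then obtain m where m: "Min (range f) = f m" by (rule imageE)
  have min: "f m \<le> f v" for v by (simp flip: m)
  have qpos: "q $ v > 0" for v using q by (simp add: is_stationary_def)
  define r where "r = p - f m *\<^sub>R q"
  have "W *v r = r"
    using p q by (simp add: r_def is_stationary_def matrix_vector_mult_diff_distrib
        matrix_vector_mult_scaleR)
  moreover have nn: "r $ v \<ge> 0" for v
    using min[of v] qpos[of v] by (simp add: r_def f_def[of v] pos_le_divide_eq)
  moreover have "r $ m = 0"
    using qpos[of m] by (simp add: r_def f_def)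
  ultimately have "\<not> r $ v > 0" for v
    using fixed_point_pos[of r v m] by auto
  then have "r = 0" using nn by (simp add: vec_eq_iff order.eq_iff not_less)
  then have eq: "p = f m *\<^sub>R q" by (simp add: r_def)
  have "(\<Sum>v\<in>UNIV. p $ v) = f m * (\<Sum>v\<in>UNIV. q $ v)"
    by (simp add: eq sum_distrib_left)
  then have "f m = 1" using p q by (simp add: is_stationary_def)
  then show ?thesis using eq by simp
qed

abbreviation "\<pi> \<equiv> stationary_distribution E w"

lemma is_stationary_stationary_distribution: "is_stationary E w \<pi>"
  unfolding stationary_distribution_def
  by (rule theI') (use is_stationary_exists is_stationary_unique in blast)

lemma stationary_distribution_pos: "\<pi> $ v > 0"
  using is_stationary_stationary_distribution by (simp add: is_stationary_def)

section \<open>The stationary Laplacian\<close>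

text \<open>\<open>mat 1 - transpose W\<close> is \<open>L\<close> with row \<open>v\<close> divided
  by \<open>deg v\<close>, so the two Laplacians differ by a positive scaling of rows.\<close>

lemma stationary_laplacian_mult_vector_nth:
  "(stationary_laplacian E w *v x) $ v = \<pi> $ v / deg v * (L *v x) $ v"
proof -
  have "((mat 1 - transpose W) *v x) $ v = x $ v - (\<Sum>u\<in>UNIV. A $ v $ u / deg v * x $ u)"
    by (simp add: matrix_vector_mult_diff_rdistrib vector_matrix_mult_def walk_matrix_nth
        mult.commute)
  also have "\<dots> = (L *v x) $ v / deg v"
    using out_degree_pos[of v]
    by (simp add: laplacian_mult_vector_nth right_diff_distrib sum_subtractf diff_divide_distrib
        sum_divide_distrib flip: sum_distrib_right out_degree_def)
  finally show ?thesis
    by (simp add: stationary_laplacian_def diag_mult_vector_nth flip: matrix_vector_mul_assoc)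
qed

text \<open>This is stationarity in disguise: column \<open>u\<close> sums to
  \<open>\<pi> $ u - (W *v \<pi>) $ u\<close>.\<close>

lemma stationary_laplacian_column_sum:
  "(\<Sum>v\<in>UNIV. stationary_laplacian E w $ v $ u) = 0"
proof -
  have "stationary_laplacian E w $ v $ u = \<pi> $ v * (mat 1 - transpose W) $ v $ u" for v
    by (simp add: stationary_laplacian_def matrix_matrix_mult_def diag_nth
        if_distrib[of "\<lambda>a. a * _"] cong: if_cong)
  then have "(\<Sum>v\<in>UNIV. stationary_laplacian E w $ v $ u) = \<pi> $ u - (W *v \<pi>) $ u"
    by (simp add: mat_def transpose_def matrix_vector_mult_def right_diff_distrib sum_subtractf
        mult.commute if_distrib[of "\<lambda>a. _ * a"] if_distrib[of "\<lambda>a. a * _"] cong: if_cong)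
  then show ?thesis
    using is_stationary_stationary_distribution by (simp add: is_stationary_def)
qed

lemma stationary_laplacian_row_sum:
  "(\<Sum>u\<in>UNIV. stationary_laplacian E w $ v $ u) = 0"
  using stationary_laplacian_mult_vector_nth[of "\<chi> u. 1" v]
  by (simp add: laplacian_mult_vector_nth) (simp add: matrix_vector_mult_def)

lemma stationary_laplacian_kernel:
  assumes "stationary_laplacian E w *v x = 0"
  shows "x $ u = x $ v"
proof (rule minimum_principle)
  fix v
  show "(L *v x) $ v \<ge> 0"
    using stationary_laplacian_mult_vector_nth[of x v] out_degree_pos[of v]
      stationary_distribution_pos[of v] by (simp add: assms)
qed

lemma pseudoinverse_stationary_laplacian:
  "pseudoinverse (stationary_laplacian E w) ** stationary_laplacian E w = mat 1 - averaging_matrix"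
proof -
  have "stationary_laplacian E w ** averaging_matrix = 0"
    by (simp add: vec_eq_iff matrix_matrix_mult_def averaging_matrix_def
        stationary_laplacian_row_sum flip: sum_divide_distrib)
  moreover have "averaging_matrix ** stationary_laplacian E w = 0"
    by (simp add: vec_eq_iff matrix_matrix_mult_def averaging_matrix_def
        stationary_laplacian_column_sum flip: sum_divide_distrib)
  ultimately show ?thesis
    using is_pseudoinverse_if_kernel_constants[of "stationary_laplacian E w"]
      stationary_laplacian_kernel pseudoinverse_eq by metis
qed

section \<open>The steady state and the flux between the leaders\<close>

text \<open>Up to sign, a kernel vector \<open>x\<close> has a nonpositive entry, hence a
  nonpositive minimum. At a minimizer, \<open>L *v x\<close> equals \<open>- k $ v * x $ v\<close>,
  which is nonnegative, so \<open>x\<close> is constant; then \<open>L *v x = 0\<close>, and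
  \<open>k $ s > 0\<close> forces the constant to be zero.\<close>

lemma grounded_laplacian_invertible:
  assumes nonneg: "\<And>v. k $ v \<ge> 0" and pos: "k $ s > 0"
  shows "invertible (L + diag k)"
proof (rule invertible_if_injective)
  have nonpos: "x = 0" if 0: "(L + diag k) *v x = 0" and u: "x $ u \<le> 0" for x :: "real ^ 'v" and u
  proof -
    have Lx: "(L *v x) $ v = - (k $ v * x $ v)" for v
      using arg_cong[OF 0, of "\<lambda>y. y $ v"]
      by (simp add: matrix_vector_mult_add_rdistrib diag_mult_vector_nth)
    have const: "x $ v = x $ s" for v
    proof (rule minimum_principle)
      fix v assume "\<And>u. x $ v \<le> x $ u"
      then have "x $ v \<le> 0" using u by (meson order_trans)
      then show "(L *v x) $ v \<ge> 0"
        using nonneg[of v] by (simp add: Lx mult_nonneg_nonpos)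
    qed
    have "x $ s - x $ v = 0" for v using const[of v] by simp
    then have "(L *v x) $ s = 0" by (simp only: laplacian_mult_vector_nth) simp
    then have "x $ s = 0" using Lx[of s] pos by simp
    then show "x = 0" using const by (simp add: vec_eq_iff)
  qed
  fix x :: "real ^ 'v" assume 0: "(L + diag k) *v x = 0"
  show "x = 0"
  proof (cases "x $ s \<le> 0")
    case True
    then show ?thesis using nonpos[OF 0] by blast
  next
    case False
    have "(L + diag k) *v (- x) = 0" using 0 matrix_vector_mult_diff_distrib[of "L + diag k" 0 x] by simp
    then show ?thesis using nonpos[of "- x" s] False by simp
  qed
qed

lemma steady_state_balance:
  assumes "s0 \<noteq> s1" and "\<kappa> $ s0 > 0" and "\<kappa> $ s1 > 0"
  defines "x \<equiv> steady_state E w \<kappa> {s0} {s1}"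
  shows "(L *v x) $ v =
    (if v = s0 then - \<kappa> $ s0 * x $ s0 else if v = s1 then \<kappa> $ s1 * (1 - x $ s1) else 0)"
proof -
  \<comment> \<open>Away from the leaders \<open>\<kappa>\<close> may have any sign; the masked
    vector is nonnegative, as invertibility requires.\<close>
  define k where "k = (\<chi> v. if v \<in> {s0} \<union> {s1} then \<kappa> $ v else 0)"
  have k: "node_indicator ({s0} \<union> {s1}) ** diag \<kappa> = diag k"
    by (simp add: node_indicator_def diag_mult_diag k_def vec_eq_iff diag_nth)
  have "invertible (L + diag k)"
    using assms(2,3) by (intro grounded_laplacian_invertible[of _ s0]) (auto simp: k_def)
  then have "(L + diag k) *v x = (node_indicator {s1} ** diag \<kappa>) *v (\<chi> v. 1)"
    by (simp only: x_def steady_state_def k matrix_inv_mult_vector)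
  then have "((L + diag k) *v x) $ v = ((node_indicator {s1} ** diag \<kappa>) *v (\<chi> v. 1)) $ v"
    by simp
  then have "(L *v x) $ v + k $ v * x $ v = (if v = s1 then \<kappa> $ v else 0)"
    by (simp add: matrix_vector_mult_add_rdistrib diag_mult_vector_nth node_indicator_def
        diag_mult_diag)
  then show ?thesis
    using assms(1) by (auto simp: k_def right_diff_distrib split: if_splits)
qed

text \<open>The pseudoinverse turns a unit flux into a difference of its columns \<open>s1\<close>
  and \<open>s0\<close>. Read in rows \<open>s0\<close> and \<open>s1\<close>, this difference is a
  domination score, with a minus sign in row \<open>s0\<close>.\<close>

lemma flux_formulas:
  fixes x :: "real ^ 'v"
  defines "\<mu> \<equiv> (\<Sum>v\<in>UNIV. x $ v) / real CARD('v)"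
  assumes "s0 \<noteq> s1"
    and flux: "stationary_laplacian E w *v x = t *\<^sub>R (axis s1 1 - axis s0 1)"
  shows "x $ s0 = \<mu> - t * domination E w s1 s0" and "x $ s1 = \<mu> + t * domination E w s0 s1"
proof -
  let ?X = "pseudoinverse (stationary_laplacian E w)"
  have "x - averaging_matrix *v x = (?X ** stationary_laplacian E w) *v x"
    by (simp add: pseudoinverse_stationary_laplacian matrix_vector_mult_diff_rdistrib)
  also have "\<dots> = t *\<^sub>R (?X *v axis s1 1 - ?X *v axis s0 1)"
    by (simp add: flux matrix_vector_mult_scaleR matrix_vector_mult_diff_distrib
        flip: matrix_vector_mul_assoc)
  finally have eq: "x - averaging_matrix *v x = t *\<^sub>R (?X *v axis s1 1 - ?X *v axis s0 1)" .
  have "x $ v = \<mu> + t * (?X $ v $ s1 - ?X $ v $ s0)" for v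
    using arg_cong[OF eq, of "\<lambda>y. y $ v"]
    by (simp add: \<mu>_def averaging_matrix_mult_vector_nth matrix_vector_mult_basis column_def)
  then show "x $ s0 = \<mu> - t * domination E w s1 s0" "x $ s1 = \<mu> + t * domination E w s0 s1"
    by (simp_all add: domination_def algebra_simps)
qed

lemma average_opinion_two_leaders:
  assumes "s0 \<noteq> s1" and "\<kappa> $ s0 > 0" and "\<kappa> $ s1 > 0"
  defines "a \<equiv> deg s0 / (\<kappa> $ s0 * \<pi> $ s0) + domination E w s1 s0"
    and "b \<equiv> deg s1 / (\<kappa> $ s1 * \<pi> $ s1) + domination E w s0 s1"
  shows "a + b > 0" and "average_opinion E w \<kappa> {s0} {s1} = a / (a + b)"
proof -
  define x where "x = steady_state E w \<kappa> {s0} {s1}"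
  define \<mu> where "\<mu> = (\<Sum>v\<in>UNIV. x $ v) / real CARD('v)"
  \<comment> \<open>The stubbornness of \<open>s\<close> after the row scaling; its inverse is the
    first summand of \<open>a\<close> or \<open>b\<close>.\<close>
  define c where "c s = \<kappa> $ s * \<pi> $ s / deg s" for s
  have c: "c s0 > 0" "c s1 > 0"
    using assms(2,3) out_degree_pos stationary_distribution_pos by (simp_all add: c_def)
  define t where "t = c s0 * x $ s0"
  note Lx = steady_state_balance[OF assms(1-3), folded x_def]
  have Mx: "(stationary_laplacian E w *v x) $ v =
      (if v = s0 then - t else if v = s1 then c s1 * (1 - x $ s1) else 0)" for v
    by (simp add: stationary_laplacian_mult_vector_nth Lx t_def c_def)
  \<comment> \<open>Zero column sums make the entries of the image total zero, so what leaves at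
    \<open>s0\<close> enters at \<open>s1\<close>. This gives a second expression for
    \<open>t\<close>.\<close>
  have "0 = (\<Sum>v\<in>UNIV. (stationary_laplacian E w *v x) $ v)"
    unfolding matrix_vector_mult_def
    by simp (subst sum.swap, simp add: stationary_laplacian_column_sum flip: sum_distrib_right)
  also have "\<dots> = (\<Sum>v\<in>{s0, s1}. (stationary_laplacian E w *v x) $ v)"
    by (rule sum.mono_neutral_right) (auto simp: Mx)
  finally have t1: "t = c s1 * (1 - x $ s1)"
    using assms(1) by (simp add: Mx)
  then have flux: "stationary_laplacian E w *v x = t *\<^sub>R (axis s1 1 - axis s0 1)"
    using assms(1) by (auto simp: vec_eq_iff Mx axis_def)
  \<comment> \<open>Otherwise \<open>x $ s0 \<le> 0\<close> and \<open>x $ s1 \<ge> 1\<close>. Then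
    \<open>s1\<close> is not a minimizer, and every minimizer satisfies the minimum principle, so
    \<open>x\<close> would be constant.\<close>
  have "t > 0"
  proof (rule ccontr)
    assume "\<not> t > 0"
    then have x0: "x $ s0 \<le> 0" and x1: "x $ s1 \<ge> 1"
      using c mult_pos_pos[of "c s0" "x $ s0"] mult_pos_pos[of "c s1" "1 - x $ s1"] t1
      unfolding t_def by linarith+
    have "x $ s0 = x $ s1"
    proof (rule minimum_principle)
      fix v assume "\<And>u. x $ v \<le> x $ u"
      from this[of s0] x0 x1 have "v \<noteq> s1" by auto
      then show "(L *v x) $ v \<ge> 0"
        using x0 assms(2) by (simp add: Lx mult_nonneg_nonpos)
    qed
    then show False using x0 x1 by simp
  qed
  note formulas = flux_formulas[OF assms(1) flux, folded \<mu>_def]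
  have a: "a = 1 / c s0 + domination E w s1 s0" and b: "b = 1 / c s1 + domination E w s0 s1"
    by (simp_all add: a_def b_def c_def)
  \<comment> \<open>Here \<open>t / c s0 = x $ s0\<close>, and below
    \<open>t / c s1 = 1 - x $ s1\<close>; the domination terms cancel against those in the flux
    formulas.\<close>
  have "\<mu> = t * a"
    using formulas(1) c(1) by (simp add: a distrib_left) (simp add: t_def)
  moreover have "1 - \<mu> = t * b"
    using formulas(2) c(2) by (simp add: b distrib_left) (simp add: t1)
  ultimately have eq: "t * (a + b) = 1" by (simp add: distrib_left)
  then show pos: "a + b > 0" using \<open>t > 0\<close> by (metis zero_less_mult_pos zero_less_one)
  have "average_opinion E w \<kappa> {s0} {s1} = \<mu>"
    by (simp add: average_opinion_def \<mu>_def x_def)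
  then show "average_opinion E w \<kappa> {s0} {s1} = a / (a + b)"
    using \<open>\<mu> = t * a\<close> eq pos by (simp add: eq_divide_eq mult.assoc mult.left_commute)
qed

end

theorem mainTheorem3:
  fixes E :: "('v::finite) rel"
    and w :: "'v \<times> 'v \<Rightarrow> real"
    and \<kappa> :: "real ^ 'v"
    and s0 s1 :: 'v
    and \<alpha> :: real
  assumes "strongly_connected E"
    and "\<And>e. e \<in> E \<Longrightarrow> w e > 0"
    and "0 \<le> \<alpha>" and "\<alpha> \<le> 1"
    and "s0 \<noteq> s1"
    and "\<kappa> $ s0 > 0" and "\<kappa> $ s1 > 0"
  defines "\<pi> \<equiv> stationary_distribution E w"
    and "d \<equiv> out_degree E w"
  shows "opinion_deviation E w \<kappa> {s0} {s1} \<alpha> =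
    \<bar>(1 - \<alpha>) * (d s0 / (\<kappa> $ s0 * \<pi> $ s0) + domination E w s1 s0)
       - \<alpha> * (d s1 / (\<kappa> $ s1 * \<pi> $ s1) + domination E w s0 s1)\<bar>
    / ((d s0 / (\<kappa> $ s0 * \<pi> $ s0) + domination E w s1 s0)
       + (d s1 / (\<kappa> $ s1 * \<pi> $ s1) + domination E w s0 s1))"
proof -
  interpret strongly_connected_digraph E w
    using assms(1,2,5) by unfold_locales blast+
  define a where "a = d s0 / (\<kappa> $ s0 * \<pi> $ s0) + domination E w s1 s0"
  define b where "b = d s1 / (\<kappa> $ s1 * \<pi> $ s1) + domination E w s0 s1"
  have pos: "a + b > 0" and avg: "average_opinion E w \<kappa> {s0} {s1} = a / (a + b)"
    using average_opinion_two_leaders[OF assms(5-7)] by (simp_all add: a_def b_def \<pi>_def d_def)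
  \<comment> \<open>Over the positive denominator \<open>a + b\<close>, the absolute value acts on
    the numerator alone.\<close>
  have "a / (a + b) - \<alpha> = ((1 - \<alpha>) * a - \<alpha> * b) / (a + b)"
    using pos by (simp add: field_simps)
  then show ?thesis
    using pos by (simp add: opinion_deviation_def avg flip: a_def b_def)
qed

end
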